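(* Let $K, r, \eta_1, \eta_2, T$ be positive integers with $r \ge 2$ and $r \mid K$. The communication load of the homogeneous hypercube coded distributed computing scheme with $K$ nodes and computation load $r$ (that is, the scheme given by Node Grouping 1, NG File Mapping, Function Assignment 1 and the NG Shuffle Method) is $$L_{\rm c}(r)=\frac{K-r}{K(r-1)}.$$
   Context: Model. There are $K$ nodes $[K]=\{1,\dots,K\}$, $N$ input files $w_1,\dots,w_N$ and $Q$ output (reduce) functions. For $i\in[Q]$, $j\in[N]$ there is an intermediate value (IV) $v_{i,j}\in\{0,1\}^T$, computed from file $w_j$ alone; function $i$ can be computed from $v_{i,1},\dots,v_{i,N}$. Node $k$ stores a set of files $\mathcal M_k$, computes all IVs $v_{i,j}$ with $i\in[Q]$, $w_j\in\mathcal M_k$, and must compute the functions in $\mathcal W_k\subseteq[Q]$. In the Shuffle phase nodes broadcast messages to each other over a shared link. The computation load is $\frac1N\sum_k|\mathcal M_k|$. The communication load is the total number of bits transmitted by all nodes in the Shuffle phase divided by $QNT$. Node Grouping 1. $[K]$ is partitioned into $r$ sets $\mathcal K_1,\dots,\mathcal K_r$, each of size $K/r$. A node group is a set $\mathcal T\subset[K]$ of size $r$ with $|\mathcal T\cap\mathcal K_i|=1$ for all $i\in[r]$. There are $X=(K/r)^r$ node groups $\mathcal T_1,\dots,\mathcal T_X$; $\mathcal T_{j,i}$ denotes the unique node in $\mathcal T_j\cap\mathcal K_i$. NG File Mapping. $N=\eta_1X$; the files are partitioned into sets $\mathcal B_1,\dots,\mathcal B_X$ of size $\eta_1$, and $\mathcal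 M_k=\bigcup_{i:\,k\in\mathcal T_i}\mathcal B_i$. Function Assignment 1. $Q=\eta_2K$; $[Q]$ is partitioned into $\mathcal W_1,\dots,\mathcal W_K$, each of size $\eta_2$. NG Shuffle Method. For $\alpha\in[X]$ and $z\in\mathcal T_\alpha$ with $z\in\mathcal K_h$, let $$\mathcal L_{z,\alpha}=\{\ell\in[X]:\mathcal T_{\ell,h}\neq z,\ \mathcal T_{\ell,i}=\mathcal T_{\alpha,i}\ \forall i\in[r]\setminus\{h\}\},$$ $$\mathcal V^{\{z\}}_{\mathcal T_\alpha\setminus z}=\bigcup_{\ell\in\mathcal L_{z,\alpha}}\{v_{i,j}: i\in\mathcal W_z,\ w_j\in\mathcal B_\ell\}.$$ The IVs of $\mathcal V^{\{z\}}_{\mathcal T_\alpha\setminus z}$ are concatenated into one bit string, which is split into $r-1$ segments of equal length, denoted $\mathcal V^{\{z\},\sigma}_{\mathcal T_\alpha\setminus z}$ and indexed by $\sigma\in\mathcal T_\alpha\setminus\{z\}$ (it is assumed that $T$ is such that the bit length is divisible by $r-1$). For every $\alpha\in[X]$ and every $k\in\mathcal T_\alpha$, node $k$ multicasts the bitwise XOR $\bigoplus_{z\in\mathcal T_\alpha\setminus\{k\}}\mathcal V^{\{z\},k}_{\mathcal T_\alpha\setminus z}$ to the nodes of $\mathcal T_\alpha\setminus\{k\}$. *)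

theory Defs
  imports Complex_Main "HOL-Library.Disjoint_Sets" "HOL-Library.FuncSet"
begin

text \<open>Nodes, files and reduce functions are the numbers \<open>1..K\<close>, \<open>1..N\<close> and \<open>1..Q\<close>.
  A bit string is a \<open>bool list\<close>.\<close>

definition equipartition :: "nat set \<Rightarrow> (nat \<Rightarrow> nat set) \<Rightarrow> nat set \<Rightarrow> nat \<Rightarrow> bool" where
  "equipartition I P A m \<longleftrightarrow>
     disjoint_family_on P I \<and> (\<Union>i\<in>I. P i) = A \<and> (\<forall>i\<in>I. card (P i) = m)"


subsection \<open>Loads of a distributed computing scheme\<close>

text \<open>A transmission on the shared link consists of the set of intended receivers and the bits
  sent. A multicast to several receivers is sent, and hence counted, once.\<close>

type_synonym transmission = "nat set \<times> bool list"

definition computation_load :: "nat \<Rightarrow> nat \<Rightarrow> (nat \<Rightarrow> nat set) \<Rightarrow> real" where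
  "computation_load K N M = (\<Sum>k=1..K. real (card (M k))) / real N"

definition communication_load ::
    "nat \<Rightarrow> nat \<Rightarrow> nat \<Rightarrow> nat \<Rightarrow> (nat \<Rightarrow> transmission list) \<Rightarrow> real" where
  "communication_load K Q N T tx =
     (\<Sum>k=1..K. real (\<Sum>t\<leftarrow>tx k. length (snd t))) / (real Q * real N * real T)"

definition bitwise_xor :: "bool list \<Rightarrow> bool list \<Rightarrow> bool list" where
  "bitwise_xor xs ys = map2 (\<noteq>) xs ys"

text \<open>The result on the empty list is a dummy value.\<close>

fun xor_all :: "bool list list \<Rightarrow> bool list" where
  "xor_all [] = []"
| "xor_all [xs] = xs"
| "xor_all (xs # ys # zss) = bitwise_xor xs (xor_all (ys # zss))"


subsection \<open>Node groups\<close>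

definition node_groups :: "nat \<Rightarrow> nat \<Rightarrow> (nat \<Rightarrow> nat set) \<Rightarrow> nat set set" where
  "node_groups K r P = {G. G \<subseteq> {1..K} \<and> card G = r \<and> (\<forall>i\<in>{1..r}. card (G \<inter> P i) = 1)}"

definition num_groups :: "nat \<Rightarrow> nat \<Rightarrow> nat" where
  "num_groups K r = (K div r) ^ r"

lemma card_node_groups:
  assumes "equipartition {1..r} P {1..K} (K div r)"
  shows "card (node_groups K r P) = num_groups K r"
proof -
  let ?I = "{1..r}"
  have disj: "i = j" if "i \<in> ?I" "j \<in> ?I" "x \<in> P i" "x \<in> P j" for i j x
    using assms that unfolding equipartition_def disjoint_family_on_def by blast
  have un: "(\<Union>i\<in>?I. P i) = {1..K}" and cd: "\<forall>i\<in>?I. card (P i) = K div r"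
    using assms unfolding equipartition_def by auto
  have "bij_betw (\<lambda>f. f ` ?I) (PiE ?I P) (node_groups K r P)"
  proof (rule bij_betw_imageI)
    show "inj_on (\<lambda>f. f ` ?I) (PiE ?I P)"
    proof (rule inj_onI)
      fix f g assume f: "f \<in> PiE ?I P" and g: "g \<in> PiE ?I P" and eq: "f ` ?I = g ` ?I"
      show "f = g"
      proof (rule PiE_ext[OF f g])
        fix i assume i: "i \<in> ?I"
        then obtain j where j: "j \<in> ?I" "f i = g j" using eq by blast
        have "f i \<in> P i" "g j \<in> P j" using PiE_mem[OF f i] PiE_mem[OF g j(1)] .
        then have "i = j" using disj[OF i j(1), of "f i"] j(2) by simp
        then show "f i = g i" using j by simp
      qed
    qed
    show "(\<lambda>f. f ` ?I) ` PiE ?I P = node_groups K r P"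
    proof (intro equalityI subsetI)
      fix G assume "G \<in> (\<lambda>f. f ` ?I) ` PiE ?I P"
      then obtain f where f: "f \<in> PiE ?I P" and G: "G = f ` ?I" by auto
      have inj: "inj_on f ?I"
      proof (rule inj_onI)
        fix i j assume ij: "i \<in> ?I" "j \<in> ?I" "f i = f j"
        show "i = j" using disj[OF ij(1,2) PiE_mem[OF f ij(1)]] PiE_mem[OF f ij(2)] ij(3) by simp
      qed
      have "G \<inter> P i = {f i}" if i: "i \<in> ?I" for i
      proof -
        have "x = f i" if "x \<in> G" "x \<in> P i" for x
        proof -
          obtain j where j: "j \<in> ?I" "x = f j" using \<open>x \<in> G\<close> G by blast
          then have "f j \<in> P j" using f by auto
          then show ?thesis using disj i j that by metis
        qed
        moreover have "f i \<in> P i" using f i by auto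
        ultimately show ?thesis using G i by blast
      qed
      moreover have "f i \<in> {1..K}" if "i \<in> ?I" for i
        using f that un by blast
      moreover have "card G = r" using card_image[OF inj] G by simp
      ultimately show "G \<in> node_groups K r P" using G unfolding node_groups_def by auto
    next
      fix G assume "G \<in> node_groups K r P"
      then have GK: "G \<subseteq> {1..K}" and G1: "\<And>i. i \<in> ?I \<Longrightarrow> card (G \<inter> P i) = 1"
        unfolding node_groups_def by auto
      define f where "f = restrict (\<lambda>i. the_elem (G \<inter> P i)) ?I"
      have fi: "G \<inter> P i = {f i}" if i: "i \<in> ?I" for i
      proof -
        obtain x where "G \<inter> P i = {x}" using G1[OF i] card_1_singletonE by blast
        then show ?thesis using i by (simp add: f_def)
      qed
      have "f \<in> PiE ?I P"
      proof (rule PiE_I)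
        show "f i \<in> P i" if "i \<in> ?I" for i using fi[OF that] by blast
        show "f i = undefined" if "i \<notin> ?I" for i using that unfolding f_def by (rule restrict_apply[THEN trans, OF if_not_P])
      qed
      moreover have "f ` ?I = G"
      proof
        show "f ` ?I \<subseteq> G" using fi by blast
        show "G \<subseteq> f ` ?I"
        proof
          fix x assume x: "x \<in> G"
          then obtain i where "i \<in> ?I" "x \<in> P i" using GK un by blast
          then show "x \<in> f ` ?I" using fi x by blast
        qed
      qed
      ultimately show "G \<in> (\<lambda>f. f ` ?I) ` PiE ?I P" by blast
    qed
  qed
  then have "card (node_groups K r P) = card (PiE ?I P)" by (metis bij_betw_same_card)
  also have "\<dots> = num_groups K r" using cd by (simp add: card_PiE num_groups_def)
  finally show ?thesis .
qed


subsection \<open>The hypercube scheme\<close>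

text \<open>
  The choices left open by the construction:
  \<^item> \<open>part S i\<close> is the \<open>i\<close>-th part of the node partition, \<open>grp S j\<close> the \<open>j\<close>-th node group,
    \<open>batch S j\<close> the \<open>j\<close>-th set of files, \<open>funs S k\<close> the set of functions assigned to node \<open>k\<close>;
  \<^item> \<open>iv S i j\<close> is the intermediate value of function \<open>i\<close> on file \<open>j\<close>;
  \<^item> \<open>concat_order S z \<alpha>\<close> is the order in which the intermediate values needed by \<open>z\<close> and shared
    by the other nodes of group \<open>\<alpha>\<close> are concatenated;
  \<^item> \<open>seg_pos S z \<alpha> \<sigma>\<close> is the position (from \<open>0\<close> to \<open>r - 2\<close>) of the segment labelled by
    node \<open>\<sigma>\<close> in that concatenation.
\<close>

record hypercube_choice =
  part :: "nat \<Rightarrow> nat set"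
  grp :: "nat \<Rightarrow> nat set"
  batch :: "nat \<Rightarrow> nat set"
  funs :: "nat \<Rightarrow> nat set"
  iv :: "nat \<Rightarrow> nat \<Rightarrow> bool list"
  concat_order :: "nat \<Rightarrow> nat \<Rightarrow> (nat \<times> nat) list"
  seg_pos :: "nat \<Rightarrow> nat \<Rightarrow> nat \<Rightarrow> nat"

definition group_node :: "hypercube_choice \<Rightarrow> nat \<Rightarrow> nat \<Rightarrow> nat" where
  "group_node S j i = the_elem (grp S j \<inter> part S i)"

definition stored_files :: "nat \<Rightarrow> nat \<Rightarrow> hypercube_choice \<Rightarrow> nat \<Rightarrow> nat set" where
  "stored_files K r S k = \<Union> {batch S i | i. i \<in> {1..num_groups K r} \<and> k \<in> grp S i}"

text \<open>For \<open>z\<close> in group \<open>\<alpha>\<close>, the index \<open>h\<close> of the part containing \<open>z\<close> is unique.\<close>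

definition neighbour_groups :: "nat \<Rightarrow> nat \<Rightarrow> hypercube_choice \<Rightarrow> nat \<Rightarrow> nat \<Rightarrow> nat set" where
  "neighbour_groups K r S z \<alpha> =
     {l \<in> {1..num_groups K r}. \<exists>h\<in>{1..r}. z \<in> part S h \<and> group_node S l h \<noteq> z \<and>
        (\<forall>i\<in>{1..r} - {h}. group_node S l i = group_node S \<alpha> i)}"

text \<open>Intermediate values are identified by their index pairs (function, file), so that values
  that happen to be equal as bit strings are not merged.\<close>

definition needed_ivs ::
    "nat \<Rightarrow> nat \<Rightarrow> hypercube_choice \<Rightarrow> nat \<Rightarrow> nat \<Rightarrow> (nat \<times> nat) set" where
  "needed_ivs K r S z \<alpha> = (\<Union>l\<in>neighbour_groups K r S z \<alpha>. {(i, j). i \<in> funs S z \<and> j \<in> batch S l})"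

definition iv_string :: "hypercube_choice \<Rightarrow> nat \<Rightarrow> nat \<Rightarrow> bool list" where
  "iv_string S z \<alpha> = concat (map (\<lambda>(i, j). iv S i j) (concat_order S z \<alpha>))"

definition segment :: "nat \<Rightarrow> hypercube_choice \<Rightarrow> nat \<Rightarrow> nat \<Rightarrow> nat \<Rightarrow> bool list" where
  "segment r S z \<alpha> \<sigma> =
     (let b = iv_string S z \<alpha>; m = length b div (r - 1)
      in take m (drop (seg_pos S z \<alpha> \<sigma> * m) b))"

definition coded_message :: "nat \<Rightarrow> hypercube_choice \<Rightarrow> nat \<Rightarrow> nat \<Rightarrow> bool list" where
  "coded_message r S k \<alpha> =
     xor_all (map (\<lambda>z. segment r S z \<alpha> k) (sorted_list_of_set (grp S \<alpha> - {k})))"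

definition ng_shuffle :: "nat \<Rightarrow> nat \<Rightarrow> hypercube_choice \<Rightarrow> nat \<Rightarrow> transmission list" where
  "ng_shuffle K r S k =
     map (\<lambda>\<alpha>. (grp S \<alpha> - {k}, coded_message r S k \<alpha>))
       (filter (\<lambda>\<alpha>. k \<in> grp S \<alpha>) [1..<Suc (num_groups K r)])"

text \<open>The last assumption is the divisibility condition on \<open>T\<close>: every string that is to be split
  has a length divisible by \<open>r - 1\<close>.\<close>

locale hypercube_scheme =
  fixes K r \<eta>1 \<eta>2 T N Q :: nat and S :: hypercube_choice
  assumes node_partition: "equipartition {1..r} (part S) {1..K} (K div r)"
    and group_enumeration: "bij_betw (grp S) {1..num_groups K r} (node_groups K r (part S))"
    and num_files: "N = \<eta>1 * num_groups K r"
    and file_partition: "equipartition {1..num_groups K r} (batch S) {1..N} \<eta>1"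
    and num_functions: "Q = \<eta>2 * K"
    and function_partition: "equipartition {1..K} (funs S) {1..Q} \<eta>2"
    and iv_length: "\<lbrakk>i \<in> {1..Q}; j \<in> {1..N}\<rbrakk> \<Longrightarrow> length (iv S i j) = T"
    and concat_order: "\<lbrakk>\<alpha> \<in> {1..num_groups K r}; z \<in> grp S \<alpha>\<rbrakk> \<Longrightarrow>
          distinct (concat_order S z \<alpha>) \<and> set (concat_order S z \<alpha>) = needed_ivs K r S z \<alpha>"
    and seg_pos: "\<lbrakk>\<alpha> \<in> {1..num_groups K r}; z \<in> grp S \<alpha>\<rbrakk> \<Longrightarrow>
          bij_betw (seg_pos S z \<alpha>) (grp S \<alpha> - {z}) {..<r - 1}"
    and splittable: "\<lbrakk>\<alpha> \<in> {1..num_groups K r}; z \<in> grp S \<alpha>\<rbrakk> \<Longrightarrow>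
          (r - 1) dvd length (iv_string S z \<alpha>)"


subsection \<open>Existence of the scheme\<close>

lemma equipartition_exists:
  fixes n m :: nat
  shows "\<exists>P. equipartition {1..n} P {1..m * n} m"
proof
  let ?P = "\<lambda>i. {(i - 1) * m + 1 .. i * m}"
  have cov: "(\<Union>i\<in>{1..k}. ?P i) = {1..m * k}" for k
  proof (induction k)
    case (Suc k)
    have "{1..Suc k} = insert (Suc k) {1..k}" by auto
    then have "(\<Union>i\<in>{1..Suc k}. ?P i) = ?P (Suc k) \<union> {1..m * k}" using Suc by simp
    also have "\<dots> = {1..m * Suc k}" by (auto simp: algebra_simps)
    finally show ?case .
  qed auto
  have lt: "?P i \<inter> ?P j = {}" if "i < j" for i j
  proof -
    have "i * m \<le> (j - 1) * m" using that by (intro mult_right_mono) auto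
    then have "x \<notin> ?P j" if "x \<in> ?P i" for x
      using that unfolding atLeastAtMost_iff by linarith
    then show ?thesis by blast
  qed
  have "disjoint_family_on ?P {1..n}" unfolding disjoint_family_on_def
    by (metis lt nat_neq_iff Int_commute)
  moreover have "card (?P i) = m" if "i \<in> {1..n}" for i
    using that by (cases i) auto
  ultimately show "equipartition {1..n} ?P {1..m * n} m"
    unfolding equipartition_def using cov[of n] by auto
qed

lemma hypercube_scheme_exists:
  assumes "r \<ge> 2" "r dvd K" "(r - 1) dvd T"
  shows "\<exists>S. hypercube_scheme K r \<eta>1 \<eta>2 T (\<eta>1 * num_groups K r) (\<eta>2 * K) S"
proof -
  let ?X = "num_groups K r"
  obtain P where P: "equipartition {1..r} P {1..K} (K div r)"
    using equipartition_exists[of r "K div r"] assms by auto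
  obtain B where B: "equipartition {1..?X} B {1..\<eta>1 * ?X} \<eta>1"
    using equipartition_exists by blast
  obtain W where W: "equipartition {1..K} W {1..\<eta>2 * K} \<eta>2"
    using equipartition_exists by blast
  have "finite (node_groups K r P)"
    by (rule finite_subset[of _ "Pow {1..K}"]) (auto simp: node_groups_def)
  then obtain g where g: "bij_betw g {1..?X} (node_groups K r P)"
    using ex_bij_betw_nat_finite_1 card_node_groups[OF P] by metis
  define S0 where "S0 = \<lparr>part = P, grp = g, batch = B, funs = W, iv = \<lambda>_ _. replicate T False,
    concat_order = \<lambda>_ _. [], seg_pos = \<lambda>_ _ _. 0\<rparr>"
  define co where "co z \<alpha> = (SOME xs. distinct xs \<and> set xs = needed_ivs K r S0 z \<alpha>)" for z \<alpha>
  define sp where "sp z \<alpha> = (SOME f. bij_betw f (g \<alpha> - {z}) {..<r - 1})" for z \<alpha>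
  define S where "S = S0\<lparr>concat_order := co, seg_pos := sp\<rparr>"
  have nd: "needed_ivs K r S z \<alpha> = needed_ivs K r S0 z \<alpha>" for z \<alpha>
    by (simp add: needed_ivs_def neighbour_groups_def group_node_def S_def)
  have finB: "finite (B l)" if "l \<in> {1..?X}" for l
    using B that unfolding equipartition_def by (metis UN_upper finite_atLeastAtMost finite_subset)
  have finW: "finite (W l)" if "l \<in> {1..K}" for l
    using W that unfolding equipartition_def by (metis UN_upper finite_atLeastAtMost finite_subset)
  have gK: "g \<alpha> \<subseteq> {1..K}" "card (g \<alpha>) = r" if "\<alpha> \<in> {1..?X}" for \<alpha>
    using bij_betwE[OF g] that unfolding node_groups_def by auto
  have fin: "finite (needed_ivs K r S0 z \<alpha>)" if "z \<in> {1..K}" for z \<alpha>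
  proof -
    have "needed_ivs K r S0 z \<alpha> \<subseteq> W z \<times> (\<Union>l\<in>{1..?X}. B l)"
      by (auto simp: needed_ivs_def neighbour_groups_def S0_def)
    moreover have "finite (W z \<times> (\<Union>l\<in>{1..?X}. B l))" using finW[OF that] finB by auto
    ultimately show ?thesis by (rule finite_subset)
  qed
  have co: "distinct (co z \<alpha>) \<and> set (co z \<alpha>) = needed_ivs K r S0 z \<alpha>" if "z \<in> {1..K}" for z \<alpha>
    unfolding co_def by (rule someI_ex) (metis fin[OF that] finite_distinct_list)
  have sp: "bij_betw (sp z \<alpha>) (g \<alpha> - {z}) {..<r - 1}" if "\<alpha> \<in> {1..?X}" "z \<in> g \<alpha>" for z \<alpha>
  proof -
    have "finite (g \<alpha>)" using gK that finite_subset by blast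
    then have "card (g \<alpha> - {z}) = card {..<r - 1}" using gK that by simp
    then show ?thesis unfolding sp_def
      by (intro someI_ex[of "\<lambda>f. bij_betw f (g \<alpha> - {z}) {..<r - 1}"] finite_same_card_bij)
         (use \<open>finite (g \<alpha>)\<close> in auto)
  qed
  have dv: "(r - 1) dvd length (concat (map (\<lambda>(i, j). replicate T False) xs))" for xs :: "(nat \<times> nat) list"
    using assms by (induction xs) auto
  have "hypercube_scheme K r \<eta>1 \<eta>2 T (\<eta>1 * ?X) (\<eta>2 * K) S"
  proof
    fix \<alpha> z assume a: "\<alpha> \<in> {1..?X}" "z \<in> grp S \<alpha>"
    then have z: "z \<in> g \<alpha>" "z \<in> {1..K}" using gK[of \<alpha>] by (auto simp: S_def S0_def)
    show "distinct (concat_order S z \<alpha>) \<and> set (concat_order S z \<alpha>) = needed_ivs K r S z \<alpha>"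
      using co[OF z(2)] nd by (simp add: S_def)
    show "bij_betw (seg_pos S z \<alpha>) (grp S \<alpha> - {z}) {..<r - 1}"
      using sp[OF a(1) z(1)] by (simp add: S_def S0_def)
    show "(r - 1) dvd length (iv_string S z \<alpha>)"
      using dv by (simp add: iv_string_def S_def S0_def)
  qed (use P g B W in \<open>auto simp: S_def S0_def\<close>)
  then show ?thesis by blast
qed

end

theory Submission
  imports Defs
begin

text \<open>Double counting the pairs of a node and a group containing it gives \<open>X * r\<close>; this yields
  the computation load at once. Replacing \<open>z\<close> in a group by any other node of its part
  gives exactly the neighbouring groups, so there are \<open>K div r - 1\<close> of them and each of the
  \<open>X * r\<close> messages has \<open>(K div r - 1) * \<eta>1 * \<eta>2 * T / (r - 1)\<close> bits.\<close>

section \<open>Sizes of unions of parts and lengths of combined strings\<close>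

lemma card_equipartition_UN:
  assumes P: "equipartition I P A m" and J: "J \<subseteq> I" "finite J" and "finite A"
  shows "card (\<Union>i\<in>J. P i) = card J * m"
proof -
  have un: "(\<Union>i\<in>I. P i) = A"
    using P by (simp add: equipartition_def)
  have "finite (P i)" if "i \<in> J" for i
    by (rule finite_subset[OF _ \<open>finite A\<close>]) (use un J that in blast)
  moreover have "P i \<inter> P j = {}" if "i \<in> J" "j \<in> J" "i \<noteq> j" for i j
    using P J that unfolding equipartition_def disjoint_family_on_def by blast
  ultimately have "card (\<Union>i\<in>J. P i) = (\<Sum>i\<in>J. card (P i))"
    using J by (intro card_UN_disjoint) auto
  also have "\<dots> = (\<Sum>i\<in>J. m)"
    using P J by (intro sum.cong) (auto simp: equipartition_def)
  finally show ?thesis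
    by simp
qed

lemma length_bitwise_xor [simp]: "length (bitwise_xor xs ys) = min (length xs) (length ys)"
  by (simp add: bitwise_xor_def)

text \<open>\<open>bitwise_xor\<close> truncates to the shorter argument, so a common length is
  preserved. Nonemptiness excludes the dummy value \<open>[]\<close> of
  \<open>xor_all\<close>.\<close>

lemma length_xor_all:
  "\<lbrakk>xss \<noteq> []; \<And>xs. xs \<in> set xss \<Longrightarrow> length xs = n\<rbrakk> \<Longrightarrow> length (xor_all xss) = n"
  by (induction xss rule: xor_all.induct) auto

lemma length_concat_map_const:
  "(\<And>x. x \<in> set xs \<Longrightarrow> length (f x) = n) \<Longrightarrow> length (concat (map f xs)) = length xs * n"
  by (induction xs) auto

context hypercube_scheme
begin

section \<open>Node groups as transversals of the parts\<close>

lemma parts_disjoint: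
  "\<lbrakk>i \<in> {1..r}; j \<in> {1..r}; x \<in> part S i; x \<in> part S j\<rbrakk> \<Longrightarrow> i = j"
  using node_partition unfolding equipartition_def disjoint_family_on_def by blast

lemma UN_parts: "(\<Union>i\<in>{1..r}. part S i) = {1..K}"
  using node_partition by (simp add: equipartition_def)

lemma grp_in_node_groups:
  "\<alpha> \<in> {1..num_groups K r} \<Longrightarrow> grp S \<alpha> \<in> node_groups K r (part S)"
  using group_enumeration by (rule bij_betwE[THEN bspec])

lemma grp_subset: "\<alpha> \<in> {1..num_groups K r} \<Longrightarrow> grp S \<alpha> \<subseteq> {1..K}"
  and card_grp: "\<alpha> \<in> {1..num_groups K r} \<Longrightarrow> card (grp S \<alpha>) = r"
  using grp_in_node_groups by (auto simp: node_groups_def)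

lemma finite_grp: "\<alpha> \<in> {1..num_groups K r} \<Longrightarrow> finite (grp S \<alpha>)"
  using grp_subset finite_subset by blast

lemma grp_Int_part:
  assumes "\<alpha> \<in> {1..num_groups K r}" "i \<in> {1..r}"
  shows "grp S \<alpha> \<inter> part S i = {group_node S \<alpha> i}"
proof -
  have "card (grp S \<alpha> \<inter> part S i) = 1"
    using grp_in_node_groups assms by (auto simp: node_groups_def)
  then obtain x where "grp S \<alpha> \<inter> part S i = {x}"
    by (rule card_1_singletonE)
  then show ?thesis
    by (simp add: group_node_def)
qed

text \<open>The parts cover all nodes and each meets the group in one node. Hence the values
  \<open>group_node S \<alpha> i\<close> act as coordinates of the group.\<close>

lemma grp_eq_image:
  assumes "\<alpha> \<in> {1..num_groups K r}"
  shows "grp S \<alpha> = group_node S \<alpha> ` {1..r}"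
proof -
  have "grp S \<alpha> = (\<Union>i\<in>{1..r}. grp S \<alpha> \<inter> part S i)"
    using grp_subset[OF assms] UN_parts by blast
  also have "\<dots> = (\<Union>i\<in>{1..r}. {group_node S \<alpha> i})"
    using grp_Int_part[OF assms] by simp
  finally show ?thesis
    by auto
qed

text \<open>Coordinates determine the group as a set, and the enumeration \<open>grp S\<close> is
  injective on indices.\<close>

lemma eq_if_group_node_eq:
  assumes "\<alpha> \<in> {1..num_groups K r}" "\<beta> \<in> {1..num_groups K r}"
    and "\<And>i. i \<in> {1..r} \<Longrightarrow> group_node S \<alpha> i = group_node S \<beta> i"
  shows "\<alpha> = \<beta>"
proof -
  have "grp S \<alpha> = grp S \<beta>"
    using assms by (simp add: grp_eq_image)
  then show ?thesis
    using group_enumeration assms by (auto simp: bij_betw_def dest: inj_onD)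
qed

text \<open>Changing one coordinate within its part leaves a transversal, hence a node group, and
  the enumeration reaches every node group. This supplies surjectivity when neighbouring groups are
  counted.\<close>

lemma exchange_node:
  assumes \<alpha>: "\<alpha> \<in> {1..num_groups K r}" and h: "h \<in> {1..r}" and y: "y \<in> part S h"
  obtains l where "l \<in> {1..num_groups K r}" "group_node S l h = y"
    "\<And>i. i \<in> {1..r} - {h} \<Longrightarrow> group_node S l i = group_node S \<alpha> i"
proof -
  define f where "f = (group_node S \<alpha>)(h := y)"
  have f: "f i \<in> part S i" if "i \<in> {1..r}" for i
    using grp_Int_part[OF \<alpha> that] y by (auto simp: f_def)
  have inj: "inj_on f {1..r}"
    by (rule inj_onI) (metis f parts_disjoint)
  have Int: "f ` {1..r} \<inter> part S i = {f i}" if "i \<in> {1..r}" for i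
    using f parts_disjoint that by blast
  have "f ` {1..r} \<in> node_groups K r (part S)"
    unfolding node_groups_def
  proof (intro CollectI conjI ballI)
    show "f ` {1..r} \<subseteq> {1..K}"
      using f UN_parts by blast
    show "card (f ` {1..r}) = r"
      using card_image[OF inj] by simp
    show "card (f ` {1..r} \<inter> part S i) = 1" if "i \<in> {1..r}" for i
      using Int[OF that] by simp
  qed
  then obtain l where l: "l \<in> {1..num_groups K r}" "grp S l = f ` {1..r}"
    using group_enumeration by (metis bij_betw_imp_surj_on imageE)
  then have "group_node S l i = f i" if "i \<in> {1..r}" for i
    using Int[OF that] by (simp add: group_node_def)
  then show ?thesis
    using that l(1) h by (simp add: f_def)
qed

section \<open>Counting neighbouring groups\<close>

lemma neighbour_groups_subset: "neighbour_groups K r S z \<alpha> \<subseteq> {1..num_groups K r}"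
  by (auto simp: neighbour_groups_def)

text \<open>All coordinates of a neighbour are prescribed except the one in the part of
  \<open>z\<close>, which may be any node other than \<open>z\<close>. Reading off that free
  coordinate is a bijection onto the part without \<open>z\<close>.\<close>

lemma card_neighbour_groups:
  assumes \<alpha>: "\<alpha> \<in> {1..num_groups K r}" and z: "z \<in> grp S \<alpha>"
  shows "card (neighbour_groups K r S z \<alpha>) = K div r - 1"
proof -
  obtain h where h: "h \<in> {1..r}" "z \<in> part S h"
    using grp_subset[OF \<alpha>] z UN_parts by blast
  \<comment> \<open>The existential over \<open>h\<close> in the definition collapses, since
    \<open>z\<close> lies in only one part.\<close>
  have nb: "neighbour_groups K r S z \<alpha> =
      {l \<in> {1..num_groups K r}. group_node S l h \<noteq> z \<and>
        (\<forall>i\<in>{1..r} - {h}. group_node S l i = group_node S \<alpha> i)}"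
  proof -
    have "h' = h" if "h' \<in> {1..r}" "z \<in> part S h'" for h'
      using parts_disjoint that h by blast
    then show ?thesis
      unfolding neighbour_groups_def using h by (intro Collect_cong) metis
  qed
  have "bij_betw (\<lambda>l. group_node S l h) (neighbour_groups K r S z \<alpha>) (part S h - {z})"
  proof (rule bij_betw_imageI)
    show "inj_on (\<lambda>l. group_node S l h) (neighbour_groups K r S z \<alpha>)"
    proof (rule inj_onI)
      fix l l' assume l: "l \<in> neighbour_groups K r S z \<alpha>" "l' \<in> neighbour_groups K r S z \<alpha>"
        and eq: "group_node S l h = group_node S l' h"
      have "group_node S l i = group_node S l' i" if "i \<in> {1..r}" for i
      proof (cases "i = h")
        case False
        then have "i \<in> {1..r} - {h}"
          using that by simp
        then show ?thesis
          using l by (simp only: nb mem_Collect_eq)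
      qed (use eq in simp)
      moreover have "l \<in> {1..num_groups K r}" "l' \<in> {1..num_groups K r}"
        using l neighbour_groups_subset by blast+
      ultimately show "l = l'"
        by (rule eq_if_group_node_eq[rotated 2])
    qed
    show "(\<lambda>l. group_node S l h) ` neighbour_groups K r S z \<alpha> = part S h - {z}"
    proof (intro equalityI subsetI)
      fix y assume "y \<in> (\<lambda>l. group_node S l h) ` neighbour_groups K r S z \<alpha>"
      then show "y \<in> part S h - {z}"
        unfolding nb using grp_Int_part[OF _ h(1)] by blast
    next
      fix y assume y: "y \<in> part S h - {z}"
      then obtain l where "l \<in> {1..num_groups K r}" "group_node S l h = y"
        "\<And>i. i \<in> {1..r} - {h} \<Longrightarrow> group_node S l i = group_node S \<alpha> i"
        using exchange_node[OF \<alpha> h(1)] by blast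
      then show "y \<in> (\<lambda>l. group_node S l h) ` neighbour_groups K r S z \<alpha>"
        unfolding nb using y by blast
    qed
  qed
  then have "card (neighbour_groups K r S z \<alpha>) = card (part S h - {z})"
    by (rule bij_betw_same_card)
  also have "\<dots> = K div r - 1"
    using node_partition h by (simp add: equipartition_def)
  finally show ?thesis .
qed

section \<open>Lengths of strings, segments and coded messages\<close>

lemma needed_ivs_eq_Times:
  "needed_ivs K r S z \<alpha> = funs S z \<times> (\<Union>l\<in>neighbour_groups K r S z \<alpha>. batch S l)"
  by (auto simp: needed_ivs_def)

lemma card_needed_ivs:
  assumes \<alpha>: "\<alpha> \<in> {1..num_groups K r}" and z: "z \<in> grp S \<alpha>"
  shows "card (needed_ivs K r S z \<alpha>) = \<eta>2 * ((K div r - 1) * \<eta>1)"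
proof -
  have "card (funs S z) = \<eta>2"
    using function_partition grp_subset[OF \<alpha>] z by (auto simp: equipartition_def)
  moreover have "card (\<Union>l\<in>neighbour_groups K r S z \<alpha>. batch S l) = (K div r - 1) * \<eta>1"
    using card_equipartition_UN[OF file_partition neighbour_groups_subset]
      finite_subset[OF neighbour_groups_subset] card_neighbour_groups[OF assms] by simp
  ultimately show ?thesis
    unfolding needed_ivs_eq_Times by (simp add: card_cartesian_product)
qed

text \<open>Every needed index pair lies in \<open>{1..Q} \<times> {1..N}\<close>, where
  \<open>iv_length\<close> gives \<open>T\<close> bits. The concatenation order is distinct, so its
  length is the number of needed pairs.\<close>

lemma length_iv_string:
  assumes \<alpha>: "\<alpha> \<in> {1..num_groups K r}" and z: "z \<in> grp S \<alpha>"
  shows "length (iv_string S z \<alpha>) = \<eta>2 * ((K div r - 1) * \<eta>1) * T"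
proof -
  have "funs S z \<subseteq> {1..Q}"
    using function_partition grp_subset[OF \<alpha>] z unfolding equipartition_def by blast
  moreover have "(\<Union>l\<in>neighbour_groups K r S z \<alpha>. batch S l) \<subseteq> {1..N}"
    using file_partition neighbour_groups_subset unfolding equipartition_def by blast
  ultimately have "needed_ivs K r S z \<alpha> \<subseteq> {1..Q} \<times> {1..N}"
    unfolding needed_ivs_eq_Times by (rule Sigma_mono)
  then have "length (iv_string S z \<alpha>) = length (concat_order S z \<alpha>) * T"
    unfolding iv_string_def using concat_order[OF assms] iv_length
    by (intro length_concat_map_const) auto
  also have "length (concat_order S z \<alpha>) = card (needed_ivs K r S z \<alpha>)"
    using concat_order[OF assms] distinct_card by fastforce
  finally show ?thesis
    using card_needed_ivs[OF assms] by simp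
qed

text \<open>With \<open>m\<close> the segment length and \<open>s\<close> its position, the slice
  ends at \<open>(s + 1) * m\<close>. As \<open>s\<close> is at most \<open>r - 2\<close>, this is
  within the string and \<open>take\<close> returns \<open>m\<close> bits.\<close>

lemma length_segment:
  assumes \<alpha>: "\<alpha> \<in> {1..num_groups K r}" and z: "z \<in> grp S \<alpha>" and k: "k \<in> grp S \<alpha> - {z}"
  shows "length (segment r S z \<alpha> k) = \<eta>2 * ((K div r - 1) * \<eta>1) * T div (r - 1)"
proof -
  let ?n = "length (iv_string S z \<alpha>)" and ?s = "seg_pos S z \<alpha> k"
  have "?s < r - 1"
    using seg_pos[OF \<alpha> z] k by (auto dest: bij_betwE)
  then have "Suc ?s * (?n div (r - 1)) \<le> (r - 1) * (?n div (r - 1))"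
    by (intro mult_right_mono) auto
  also have "\<dots> \<le> ?n"
    by (rule times_div_less_eq_dividend)
  finally have "?n div (r - 1) \<le> ?n - ?s * (?n div (r - 1))"
    by simp
  then show ?thesis
    using length_iv_string[OF \<alpha> z] by (simp add: segment_def Let_def)
qed

text \<open>All \<open>r - 1\<close> segments combined have the same length, so the XOR truncates
  nothing; \<open>r \<ge> 2\<close> ensures that there is at least one.\<close>

lemma length_coded_message:
  assumes "r \<ge> 2" and \<alpha>: "\<alpha> \<in> {1..num_groups K r}" and k: "k \<in> grp S \<alpha>"
  shows "length (coded_message r S k \<alpha>) = \<eta>2 * ((K div r - 1) * \<eta>1) * T div (r - 1)"
proof -
  have fin: "finite (grp S \<alpha> - {k})"
    using finite_grp[OF \<alpha>] by simp
  have "card (grp S \<alpha> - {k}) = r - 1"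
    using card_grp[OF \<alpha>] k by simp
  then have "length (sorted_list_of_set (grp S \<alpha> - {k})) > 0"
    using \<open>r \<ge> 2\<close> by (simp only: length_sorted_list_of_set)
  then have nonempty: "sorted_list_of_set (grp S \<alpha> - {k}) \<noteq> []"
    by (rule length_greater_0_conv[THEN iffD1])
  then show ?thesis
    unfolding coded_message_def
  proof (intro length_xor_all)
    fix xs assume "xs \<in> set (map (\<lambda>z. segment r S z \<alpha> k) (sorted_list_of_set (grp S \<alpha> - {k})))"
    then obtain z where "z \<in> grp S \<alpha> - {k}" "xs = segment r S z \<alpha> k"
      using fin by auto
    then show "length xs = \<eta>2 * ((K div r - 1) * \<eta>1) * T div (r - 1)"
      using length_segment[OF \<alpha>, of z k] k by simp
  qed (use nonempty in blast)
qed

section \<open>Totals over all nodes\<close>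

lemma sum_card_groups_of_node:
  "(\<Sum>k=1..K. card {\<alpha> \<in> {1..num_groups K r}. k \<in> grp S \<alpha>}) = num_groups K r * r"
proof -
  have "(\<Sum>k=1..K. card {\<alpha> \<in> {1..num_groups K r}. k \<in> grp S \<alpha>}) =
      (\<Sum>\<alpha>=1..num_groups K r. card {k \<in> {1..K}. k \<in> grp S \<alpha>})"
    by (rule sum_multicount_gen) auto
  also have "\<dots> = (\<Sum>\<alpha>=1..num_groups K r. r)"
  proof (rule sum.cong)
    fix \<alpha> assume \<alpha>: "\<alpha> \<in> {1..num_groups K r}"
    have "{k \<in> {1..K}. k \<in> grp S \<alpha>} = grp S \<alpha>"
      using grp_subset[OF \<alpha>] by blast
    then show "card {k \<in> {1..K}. k \<in> grp S \<alpha>} = r"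
      using card_grp[OF \<alpha>] by simp
  qed simp
  finally show ?thesis
    by simp
qed

text \<open>Batches are disjoint, so a node stores \<open>\<eta>1\<close> files for each group
  containing it, and the incidence count applies.\<close>

lemma sum_card_stored_files:
  "(\<Sum>k=1..K. card (stored_files K r S k)) = num_groups K r * r * \<eta>1"
proof -
  have "card (stored_files K r S k) = card {\<alpha> \<in> {1..num_groups K r}. k \<in> grp S \<alpha>} * \<eta>1" for k
  proof -
    have "stored_files K r S k = (\<Union>\<alpha>\<in>{\<alpha> \<in> {1..num_groups K r}. k \<in> grp S \<alpha>}. batch S \<alpha>)"
      by (auto simp: stored_files_def)
    also have "card \<dots> = card {\<alpha> \<in> {1..num_groups K r}. k \<in> grp S \<alpha>} * \<eta>1"
      by (rule card_equipartition_UN[OF file_partition]) auto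
    finally show ?thesis .
  qed
  then show ?thesis
    by (simp only: sum_card_groups_of_node flip: sum_distrib_right)
qed

text \<open>A node sends one message per group containing it, all of length \<open>?s\<close>, so
  this constant factors out of the incidence count.\<close>

lemma sum_length_ng_shuffle:
  assumes "r \<ge> 2"
  shows "(\<Sum>k=1..K. \<Sum>t\<leftarrow>ng_shuffle K r S k. length (snd t)) =
    num_groups K r * r * (\<eta>2 * ((K div r - 1) * \<eta>1) * T div (r - 1))"
    (is "_ = _ * ?s")
proof -
  have "(\<Sum>t\<leftarrow>ng_shuffle K r S k. length (snd t)) =
      card {\<alpha> \<in> {1..num_groups K r}. k \<in> grp S \<alpha>} * ?s" for k
  proof -
    let ?as = "filter (\<lambda>\<alpha>. k \<in> grp S \<alpha>) [1..<Suc (num_groups K r)]"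
    have set: "set ?as = {\<alpha> \<in> {1..num_groups K r}. k \<in> grp S \<alpha>}"
      by auto
    have "(\<Sum>t\<leftarrow>ng_shuffle K r S k. length (snd t)) =
        (\<Sum>\<alpha>\<leftarrow>?as. length (coded_message r S k \<alpha>))"
      by (simp add: ng_shuffle_def comp_def del: upt_Suc)
    \<comment> \<open>The filtered list of indices is distinct, so the list sum is a sum over its
      set.\<close>
    also have "\<dots> = (\<Sum>\<alpha>\<in>set ?as. length (coded_message r S k \<alpha>))"
      by (rule sum_list_distinct_conv_sum_set) simp
    also have "\<dots> = (\<Sum>\<alpha>\<in>set ?as. ?s)"
      unfolding set by (intro sum.cong length_coded_message[OF assms]) auto
    finally show ?thesis
      unfolding set by simp
  qed
  then show ?thesis
    by (simp only: sum_card_groups_of_node flip: sum_distrib_right)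
qed

end

theorem theorem1:
  fixes K r \<eta>1 \<eta>2 T N Q :: nat and S :: hypercube_choice
  assumes "K > 0" and "r \<ge> 2" and "r dvd K" and "\<eta>1 > 0" and "\<eta>2 > 0" and "T > 0"
    and "hypercube_scheme K r \<eta>1 \<eta>2 T N Q S"
  shows "computation_load K N (stored_files K r S) = real r \<and>
    communication_load K Q N T (ng_shuffle K r S) = (real K - real r) / (real K * (real r - 1))"
proof -
  interpret hypercube_scheme K r \<eta>1 \<eta>2 T N Q S
    by fact
  let ?X = "num_groups K r" and ?L = "\<eta>2 * ((K div r - 1) * \<eta>1) * T"
  obtain m where K: "K = r * m"
    using \<open>r dvd K\<close> by blast
  with \<open>K > 0\<close> have m: "m > 0" and div: "K div r = m"
    by auto
  then have X: "?X > 0"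
    by (simp add: num_groups_def)
  have "computation_load K N (stored_files K r S) = real (?X * r * \<eta>1) / real N"
    unfolding computation_load_def by (simp only: sum_card_stored_files flip: of_nat_sum)
  also have "\<dots> = real r"
    using X \<open>\<eta>1 > 0\<close> num_files by simp
  finally have comp: "computation_load K N (stored_files K r S) = real r" .
  \<comment> \<open>\<open>?L\<close> is the length of every string to be split, so
    \<open>splittable\<close> at group 1 suffices. This turns the natural-number quotient into an
    exact real one.\<close>
  have dvd: "(r - 1) dvd ?L"
  proof -
    have 1: "1 \<in> {1..?X}"
      using X by simp
    then obtain z where "z \<in> grp S 1"
      using card_grp[OF 1] \<open>r \<ge> 2\<close> by fastforce
    then show ?thesis
      using splittable[OF 1] length_iv_string[OF 1] by metis
  qed
  have "communication_load K Q N T (ng_shuffle K r S) =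
      real (\<Sum>k=1..K. \<Sum>t\<leftarrow>ng_shuffle K r S k. length (snd t)) / (real Q * real N * real T)"
    unfolding communication_load_def by (simp flip: sum_divide_distrib)
  also have "\<dots> = real (?X * r) * (real ?L / real (r - 1)) / (real Q * real N * real T)"
    unfolding sum_length_ng_shuffle[OF \<open>r \<ge> 2\<close>] of_nat_mult[of "?X * r"] real_of_nat_div[OF dvd] ..
  \<comment> \<open>The factors \<open>?X\<close>, \<open>\<eta>1\<close>, \<open>\<eta>2\<close>
    and \<open>T\<close> are positive and cancel against \<open>Q * N * T\<close>;
    \<open>m > 0\<close> makes the truncated difference \<open>m - 1\<close> agree with the real
    one.\<close>
  also have "\<dots> = real r * (real m - 1) / (real K * (real r - 1))"
    using X m \<open>\<eta>1 > 0\<close> \<open>\<eta>2 > 0\<close> \<open>T > 0\<close> \<open>r \<ge> 2\<close> \<open>K > 0\<close>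
    by (simp add: num_files num_functions div of_nat_diff Suc_leI field_simps)
  also have "real r * (real m - 1) = real K - real r"
    using K by (simp add: algebra_simps)
  finally show ?thesis
    using comp by simp
qed

end
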